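(* Let $k\in\mathcal{K}_\omega$, $f\in L^1([a,b];\mathbb{R})$ and $g\in L^\infty([a,b];\mathbb{R})$. Then $$\int_a^b (I_a^kf)(x)\, g(x)\, \omega(x)\,dx=\int_a^b (I_b^kg)(x)\, f(x)\,\omega(x)\,dx.$$
   Context: Let $a<b$ be real numbers, $\mathbb{R}_+=(0,+\infty)$, and $\Omega=\{(x,y)\in[a,b]\times[a,b] : x>y\}$. Fix a weight function $\omega:[a,b]\to\mathbb{R}_+$ such that $\omega,\omega^{-1}\in L^\infty([a,b];\mathbb{R})$, where $\omega^{-1}=1/\omega$. For a (measurable) kernel-function $k:\Omega\to\mathbb{R}_+$ put $F_k(y)=\int_y^b k(x,y)\omega(x)\,dx$ for $y\in[a,b)$ and $G_k(y)=\int_a^y k(y,x)\omega(x)\,dx$ for $y\in(a,b]$. Let $\mathcal{K}_\omega$ be the set of measurable $k:\Omega\to\mathbb{R}_+$ such that $F_k\in L^\infty([a,b);\mathbb{R})$ and $G_k\in L^\infty((a,b];\mathbb{R})$. For $k\in\mathcal{K}_\omega$ and $f\in L^1([a,b];\mathbb{R})$, the left- and right-sided $k$-integrals of $f$ are, for a.e. $x\in[a,b]$, $(I_a^kf)(x)=\int_a^x k(x,y)f(y)\omega(y)\,dy$ and $(I_b^kf)(x)=\int_x^b k(y,x)f(y)\omega(y)\,dy$. *)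

theory Defs
  imports "HOL-Analysis.Analysis"
begin

text \<open>
  Functions on a subset of \<open>\<real>\<close> or \<open>\<real>\<^sup>2\<close> are total functions whose values outside that
  subset are never used. Measurability and integrals are with respect to Lebesgue
  (not just Borel) measure. Membership in \<open>L\<^sup>1[a,b]\<close> is \<open>absolutely_integrable_on {a..b}\<close>.
\<close>

definition Linf_on :: "real set \<Rightarrow> (real \<Rightarrow> real) \<Rightarrow> bool" where
  "Linf_on S f \<longleftrightarrow>
     f \<in> borel_measurable (lebesgue_on S) \<and>
     (\<exists>C. AE x in lebesgue_on S. \<bar>f x\<bar> \<le> C)"

definition weight :: "real \<Rightarrow> real \<Rightarrow> (real \<Rightarrow> real) \<Rightarrow> bool" where
  "weight a b \<omega> \<longleftrightarrow>
     (\<forall>x\<in>{a..b}. \<omega> x > 0) \<and>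
     Linf_on {a..b} \<omega> \<and> Linf_on {a..b} (\<lambda>x. 1 / \<omega> x)"

definition Omega :: "real \<Rightarrow> real \<Rightarrow> (real \<times> real) set" where
  "Omega a b = {(x, y). x \<in> {a..b} \<and> y \<in> {a..b} \<and> x > y}"

text \<open>
  \<open>F\<^sub>k\<close> and \<open>G\<^sub>k\<close> are integrals of positive functions and may be infinite. They take values in
  \<^typ>\<open>ennreal\<close>, because the Bochner integral would assign a divergent integral the value \<open>0\<close>.
\<close>

definition F_ker :: "real \<Rightarrow> (real \<Rightarrow> real) \<Rightarrow> (real \<times> real \<Rightarrow> real) \<Rightarrow> real \<Rightarrow> ennreal" where
  "F_ker b \<omega> k y = (\<integral>\<^sup>+x\<in>{y<..b}. ennreal (k (x, y) * \<omega> x) \<partial>lebesgue)"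

definition G_ker :: "real \<Rightarrow> (real \<Rightarrow> real) \<Rightarrow> (real \<times> real \<Rightarrow> real) \<Rightarrow> real \<Rightarrow> ennreal" where
  "G_ker a \<omega> k y = (\<integral>\<^sup>+x\<in>{a..<y}. ennreal (k (y, x) * \<omega> x) \<partial>lebesgue)"

text \<open>An \<^typ>\<open>ennreal\<close>-valued function is in \<open>L\<^sup>\<infinity>(S;\<real>)\<close> if it is finite almost everywhere
  and its real version is in \<open>L\<^sup>\<infinity>\<close>.\<close>

definition Linf_on_ennreal :: "real set \<Rightarrow> (real \<Rightarrow> ennreal) \<Rightarrow> bool" where
  "Linf_on_ennreal S F \<longleftrightarrow>
     (AE x in lebesgue_on S. F x < \<infinity>) \<and> Linf_on S (\<lambda>x. enn2real (F x))"

definition kernels :: "real \<Rightarrow> real \<Rightarrow> (real \<Rightarrow> real) \<Rightarrow> (real \<times> real \<Rightarrow> real) set" where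
  "kernels a b \<omega> =
     {k. k \<in> borel_measurable (lebesgue_on (Omega a b)) \<and>
         (\<forall>p\<in>Omega a b. k p > 0) \<and>
         Linf_on_ennreal {a..<b} (F_ker b \<omega> k) \<and>
         Linf_on_ennreal {a<..b} (G_ker a \<omega> k)}"

text \<open>The half-open domains of integration are the sections of \<^const>\<open>Omega\<close>, on which \<open>k\<close> is given.\<close>

definition left_integral ::
  "real \<Rightarrow> (real \<Rightarrow> real) \<Rightarrow> (real \<times> real \<Rightarrow> real) \<Rightarrow> (real \<Rightarrow> real) \<Rightarrow> real \<Rightarrow> real" where
  "left_integral a \<omega> k f x = (LINT y:{a..<x}|lebesgue. k (x, y) * f y * \<omega> y)"

definition right_integral ::
  "real \<Rightarrow> (real \<Rightarrow> real) \<Rightarrow> (real \<times> real \<Rightarrow> real) \<Rightarrow> (real \<Rightarrow> real) \<Rightarrow> real \<Rightarrow> real" where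
  "right_integral b \<omega> k f x = (LINT y:{x<..b}|lebesgue. k (y, x) * f y * \<omega> y)"

end

theory Submission
  imports Defs
begin

text \<open>
  Both sides are the iterated integrals, in the two orders, of
  \<open>h (x, y) = k (x, y) f(y) \<omega>(y) g(x) \<omega>(x)\<close> over \<open>Omega\<close>. The double integral of \<open>\<bar>h\<bar>\<close> is at most
  \<open>\<parallel>g\<parallel>\<^sub>\<infinity> \<parallel>F\<^sub>k\<parallel>\<^sub>\<infinity> \<parallel>\<omega>\<parallel>\<^sub>\<infinity> \<parallel>f\<parallel>\<^sub>1\<close>, so Fubini applies. Since Lebesgue
  measure on the plane is the completion of the product measure, Fubini is first transferred to
  Lebesgue measurable functions through an almost everywhere equal Borel function.
\<close>

section \<open>Lifting null sets and measurability from one factor to the product\<close>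

lemma AE_lborel_fst:
  assumes "AE x in (lborel :: 'a::euclidean_space measure). P x"
  shows "AE z in (lborel :: ('a \<times> 'b::euclidean_space) measure). P (fst z)"
proof -
  obtain N where N: "{x \<in> space lborel. \<not> P x} \<subseteq> N" "emeasure lborel N = 0" "N \<in> sets (lborel :: 'a measure)"
    using assms by (rule AE_E)
  \<comment> \<open>A cylinder over a null set is null although its other side has infinite measure,
    because \<open>0 * \<infinity> = 0\<close> in \<open>ennreal\<close>.\<close>
  have "emeasure (lborel \<Otimes>\<^sub>M (lborel :: 'b measure)) (N \<times> UNIV) = 0"
    using N lborel.emeasure_pair_measure_Times[of N lborel UNIV] by simp
  moreover have "N \<times> UNIV \<in> sets (lborel \<Otimes>\<^sub>M (lborel :: 'b measure))"
    using N(3) by (intro pair_measureI) auto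
  ultimately show ?thesis
    using N(1) unfolding lborel_prod by (intro AE_I[where N = "N \<times> UNIV"]) auto
qed

lemma AE_lborel_snd:
  assumes "AE x in (lborel :: 'b::euclidean_space measure). P x"
  shows "AE z in (lborel :: ('a::euclidean_space \<times> 'b) measure). P (snd z)"
proof -
  obtain N where N: "{x \<in> space lborel. \<not> P x} \<subseteq> N" "emeasure lborel N = 0" "N \<in> sets (lborel :: 'b measure)"
    using assms by (rule AE_E)
  have "emeasure ((lborel :: 'a measure) \<Otimes>\<^sub>M lborel) (UNIV \<times> N) = 0"
    using N lborel.emeasure_pair_measure_Times[of UNIV lborel N] by simp
  moreover have "UNIV \<times> N \<in> sets ((lborel :: 'a measure) \<Otimes>\<^sub>M lborel)"
    using N(3) by (intro pair_measureI) auto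
  ultimately show ?thesis
    using N(1) unfolding lborel_prod by (intro AE_I[where N = "UNIV \<times> N"]) auto
qed

text \<open>A Borel version \<open>h'\<close> of \<open>h\<close> composes with the projection
  without trouble. The set where the two differ lifts to a null cylinder, which the completion
  absorbs.\<close>

lemma borel_measurable_lebesgue_fst:
  fixes h :: "'a::euclidean_space \<Rightarrow> real"
  assumes "h \<in> borel_measurable lebesgue"
  shows "(\<lambda>z. h (fst z)) \<in> borel_measurable (lebesgue :: ('a \<times> 'b::euclidean_space) measure)"
proof -
  obtain h' where [measurable]: "h' \<in> borel_measurable borel" and eq: "AE x in lborel. h x = h' x"
    using completion_ex_borel_measurable_real[OF assms] by auto
  have "AE z in (lebesgue :: ('a \<times> 'b) measure). h' (fst z) = h (fst z)"
    using AE_lborel_fst[OF eq] by (intro AE_completion) auto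
  moreover have "(\<lambda>z. h' (fst z)) \<in> borel_measurable (lborel :: ('a \<times> 'b) measure)"
    unfolding lborel_prod[symmetric] by measurable
  ultimately show ?thesis
    by (intro borel_measurable_AE[OF measurable_completion])
qed

lemma borel_measurable_lebesgue_snd:
  fixes h :: "'b::euclidean_space \<Rightarrow> real"
  assumes "h \<in> borel_measurable lebesgue"
  shows "(\<lambda>z. h (snd z)) \<in> borel_measurable (lebesgue :: ('a::euclidean_space \<times> 'b) measure)"
proof -
  obtain h' where [measurable]: "h' \<in> borel_measurable borel" and eq: "AE x in lborel. h x = h' x"
    using completion_ex_borel_measurable_real[OF assms] by auto
  have "AE z in (lebesgue :: ('a \<times> 'b) measure). h' (snd z) = h (snd z)"
    using AE_lborel_snd[OF eq] by (intro AE_completion) auto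
  moreover have "(\<lambda>z. h' (snd z)) \<in> borel_measurable (lborel :: ('a \<times> 'b) measure)"
    unfolding lborel_prod[symmetric] by measurable
  ultimately show ?thesis
    by (intro borel_measurable_AE[OF measurable_completion])
qed

section \<open>Fubini for Lebesgue measurable functions on the product\<close>

text \<open>Measurability of \<open>h\<close> follows from completeness and is not assumed. This
  matters for Fubini, where \<open>h\<close> is a section or an inner integral whose measurability
  is not known beforehand.\<close>

lemma integral_lebesgue_cong_AE:
  fixes h h' :: "'a::euclidean_space \<Rightarrow> real"
  assumes "h' \<in> borel_measurable borel" "AE x in lborel. h x = h' x"
  shows "integral\<^sup>L lebesgue h = integral\<^sup>L lborel h'"
proof -
  have h': "h' \<in> borel_measurable lborel" "h' \<in> borel_measurable lebesgue"
    using assms(1) by (auto intro: measurable_completion)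
  have eq: "AE x in lebesgue. h' x = h x"
    using assms(2) by (intro AE_completion) auto
  have "integral\<^sup>L lebesgue h = integral\<^sup>L lebesgue h'"
    using h'(2) borel_measurable_AE[OF h'(2) eq] eq by (intro integral_cong_AE) auto
  then show ?thesis
    using integral_completion[OF h'(1)] by simp
qed

text \<open>One Borel function must serve both orders of integration. It does, because almost all
  sections of a null set are null, in either direction.\<close>

lemma lebesgue_pair_borel_version:
  fixes h :: "'a::euclidean_space \<times> 'b::euclidean_space \<Rightarrow> real"
  assumes "h \<in> borel_measurable lebesgue"
  obtains h' where "h' \<in> borel_measurable (lborel \<Otimes>\<^sub>M lborel)"
    and "AE x in lborel. AE y in lborel. h (x, y) = h' (x, y)"
    and "AE y in lborel. AE x in lborel. h (x, y) = h' (x, y)"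
proof -
  obtain h' where h': "h' \<in> borel_measurable (lborel \<Otimes>\<^sub>M lborel)"
    and eq: "AE z in lborel \<Otimes>\<^sub>M lborel. h z = h' z"
    using completion_ex_borel_measurable_real[OF assms] unfolding lborel_prod by auto
  \<comment> \<open>Swapping the coordinates carries one product measure to the other; taking
    sections of the swapped equality yields the second order.\<close>
  have "AE z in lborel \<Otimes>\<^sub>M lborel. h (snd z, fst z) = h' (snd z, fst z)"
  proof -
    have "AE z in distr (lborel \<Otimes>\<^sub>M lborel) (lborel \<Otimes>\<^sub>M lborel) (\<lambda>(x, y). (y, x)). h z = h' z"
      using eq by (subst (asm) lborel_pair.distr_pair_swap)
    then show ?thesis
      by (rule AE_distrD[rotated, THEN AE_mp]) (auto split: prod.splits)
  qed
  then show ?thesis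
    using that[OF h'] lborel_pair.AE_pair[OF eq] lborel_pair.AE_pair by fastforce
qed

text \<open>A null set of the plane can have nonmeasurable sections, so the claim is limited to
  almost every \<open>y\<close>, where the section agrees almost everywhere with that of a Borel
  version.\<close>

lemma AE_borel_measurable_lebesgue_section:
  fixes h :: "'a::euclidean_space \<times> 'b::euclidean_space \<Rightarrow> real"
  assumes "h \<in> borel_measurable lebesgue"
  shows "AE y in lebesgue. (\<lambda>x. h (x, y)) \<in> borel_measurable lebesgue"
proof -
  obtain h' where h'[measurable]: "h' \<in> borel_measurable (lborel \<Otimes>\<^sub>M lborel)"
    and eq: "AE y in lborel. AE x in lborel. h (x, y) = h' (x, y)"
    using lebesgue_pair_borel_version[OF assms] .
  have "AE y in lborel. (\<lambda>x. h (x, y)) \<in> borel_measurable lebesgue"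
    using eq
  proof eventually_elim
    case (elim y)
    have "(\<lambda>x. h' (x, y)) \<in> borel_measurable lborel"
      by measurable
    moreover have "AE x in lebesgue. h' (x, y) = h (x, y)"
      using elim by (intro AE_completion) auto
    ultimately show ?case
      by (intro borel_measurable_AE[OF measurable_completion])
  qed
  then show ?thesis
    by (rule AE_completion)
qed

lemma lebesgue_Fubini_integral:
  fixes h :: "'a::euclidean_space \<times> 'b::euclidean_space \<Rightarrow> real"
  assumes h: "h \<in> borel_measurable lebesgue"
    and fin: "(\<integral>\<^sup>+y. (\<integral>\<^sup>+x. ennreal \<bar>h (x, y)\<bar> \<partial>lebesgue) \<partial>lebesgue) < \<infinity>"
  shows "(\<integral>x. (\<integral>y. h (x, y) \<partial>lebesgue) \<partial>lebesgue) = (\<integral>y. (\<integral>x. h (x, y) \<partial>lebesgue) \<partial>lebesgue)"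
proof -
  obtain h' where h'[measurable]: "h' \<in> borel_measurable (lborel \<Otimes>\<^sub>M lborel)"
    and eq1: "AE x in lborel. AE y in lborel. h (x, y) = h' (x, y)"
    and eq2: "AE y in lborel. AE x in lborel. h (x, y) = h' (x, y)"
    using lebesgue_pair_borel_version[OF h] .
  \<comment> \<open>Tonelli for the Borel version turns finiteness of one iterated integral into
    integrability on the product.\<close>
  have "(\<integral>\<^sup>+z. ennreal \<bar>h' z\<bar> \<partial>(lborel \<Otimes>\<^sub>M lborel)) =
      (\<integral>\<^sup>+y. (\<integral>\<^sup>+x. ennreal \<bar>h' (x, y)\<bar> \<partial>lborel) \<partial>lborel)"
    by (subst lborel_pair.nn_integral_snd) auto
  also have "\<dots> = (\<integral>\<^sup>+y. (\<integral>\<^sup>+x. ennreal \<bar>h (x, y)\<bar> \<partial>lborel) \<partial>lborel)"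
    using eq2 by (intro nn_integral_cong_AE) (auto elim!: eventually_mono intro!: nn_integral_cong_AE)
  finally have "integrable (lborel \<Otimes>\<^sub>M lborel) h'"
    using fin by (auto simp: integrable_iff_bounded nn_integral_completion)
  then have "(\<integral>x. (\<integral>y. h' (x, y) \<partial>lborel) \<partial>lborel) = (\<integral>y. (\<integral>x. h' (x, y) \<partial>lborel) \<partial>lborel)"
    using lborel_pair.Fubini_integral[of "\<lambda>x y. h' (x, y)"] by simp
  moreover have "(\<integral>x. (\<integral>y. h (x, y) \<partial>lebesgue) \<partial>lebesgue) = (\<integral>x. (\<integral>y. h' (x, y) \<partial>lborel) \<partial>lborel)"
  proof (rule integral_lebesgue_cong_AE)
    have "(\<lambda>x. \<integral>y. h' (x, y) \<partial>lborel) \<in> borel_measurable lborel"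
      by measurable
    then show "(\<lambda>x. \<integral>y. h' (x, y) \<partial>lborel) \<in> borel_measurable borel"
      by simp
    show "AE x in lborel. (\<integral>y. h (x, y) \<partial>lebesgue) = (\<integral>y. h' (x, y) \<partial>lborel)"
      using eq1
    proof eventually_elim
      case (elim x)
      have "(\<lambda>y. h' (x, y)) \<in> borel_measurable lborel"
        by measurable
      then show ?case
        using elim by (intro integral_lebesgue_cong_AE) auto
    qed
  qed
  moreover have "(\<integral>y. (\<integral>x. h (x, y) \<partial>lebesgue) \<partial>lebesgue) = (\<integral>y. (\<integral>x. h' (x, y) \<partial>lborel) \<partial>lborel)"
  proof (rule integral_lebesgue_cong_AE)
    have "(\<lambda>y. \<integral>x. h' (x, y) \<partial>lborel) \<in> borel_measurable lborel"
      by measurable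
    then show "(\<lambda>y. \<integral>x. h' (x, y) \<partial>lborel) \<in> borel_measurable borel"
      by simp
    show "AE y in lborel. (\<integral>x. h (x, y) \<partial>lebesgue) = (\<integral>x. h' (x, y) \<partial>lborel)"
      using eq2
    proof eventually_elim
      case (elim y)
      have "(\<lambda>x. h' (x, y)) \<in> borel_measurable lborel"
        by measurable
      then show ?case
        using elim by (intro integral_lebesgue_cong_AE) auto
    qed
  qed
  ultimately show ?thesis
    by simp
qed

section \<open>Essential bounds and the triangular domain\<close>

lemma Linf_onE:
  assumes "Linf_on S h" and S: "S \<in> sets lebesgue"
  obtains C where "C \<ge> 0" and "AE x in lebesgue. x \<in> S \<longrightarrow> \<bar>h x\<bar> \<le> C"
    and "(\<lambda>x. indicator S x * h x) \<in> borel_measurable lebesgue"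
proof -
  obtain C where "AE x in lebesgue_on S. \<bar>h x\<bar> \<le> C" and m: "h \<in> borel_measurable (lebesgue_on S)"
    using assms(1) by (auto simp: Linf_on_def)
  then have "AE x in lebesgue. x \<in> S \<longrightarrow> \<bar>h x\<bar> \<le> C"
    using S by (simp add: AE_restrict_space_iff)
  \<comment> \<open>An essential bound may be negative when \<open>S\<close> is null, hence the
    maximum with \<open>0\<close>.\<close>
  then have "AE x in lebesgue. x \<in> S \<longrightarrow> \<bar>h x\<bar> \<le> max C 0"
    by eventually_elim auto
  moreover have "(\<lambda>x. indicator S x * h x) \<in> borel_measurable lebesgue"
    using m S by (simp add: borel_measurable_restrict_space_iff)
  ultimately show ?thesis
    using that[of "max C 0"] by simp
qed

lemma borel_Omega: "Omega a b \<in> sets borel"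
proof -
  have "Omega a b = {z \<in> space (borel \<Otimes>\<^sub>M borel). fst z \<in> {a..b} \<and> snd z \<in> {a..b} \<and> snd z < fst z}"
    by (auto simp: Omega_def space_pair_measure)
  also have "\<dots> \<in> sets (borel \<Otimes>\<^sub>M borel)"
    by measurable
  finally show ?thesis
    unfolding borel_prod .
qed

section \<open>Exchange of the integrals for the given kernel\<close>

theorem theorem3p12:
  fixes a b :: real
    and \<omega> f g :: "real \<Rightarrow> real"
    and k :: "real \<times> real \<Rightarrow> real"
  assumes "a < b"
    and "weight a b \<omega>"
    and "k \<in> kernels a b \<omega>"
    and "f absolutely_integrable_on {a..b}"
    and "Linf_on {a..b} g"
  shows "(LINT x:{a..b}|lebesgue. left_integral a \<omega> k f x * g x * \<omega> x) =
         (LINT x:{a..b}|lebesgue. right_integral b \<omega> k g x * f x * \<omega> x)"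
proof -
  \<comment> \<open>Extension by zero turns all integrals over intervals and sections of
    \<open>Omega a b\<close> into integrals over the whole line, so that Fubini applies to the
    single integrand \<open>h\<close>.\<close>
  define K where "K = (\<lambda>z. indicator (Omega a b) z * k z)"
  define W where "W = (\<lambda>x. indicator {a..b} x * \<omega> x)"
  define f0 where "f0 = (\<lambda>x. indicator {a..b} x * f x)"
  define g0 where "g0 = (\<lambda>x. indicator {a..b} x * g x)"
  define h where "h = (\<lambda>z. K z * (f0 (snd z) * W (snd z)) * (g0 (fst z) * W (fst z)))"
  have \<omega>_pos: "\<omega> x > 0" if "x \<in> {a..b}" for x
    using assms(2) that by (auto simp: weight_def)
  have k_pos: "k z > 0" if "z \<in> Omega a b" for z
    using assms(3) that by (auto simp: kernels_def)
  have K_nonneg: "K z \<ge> 0" for z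
    using k_pos by (auto simp: K_def indicator_def less_imp_le)
  have W_nonneg: "W x \<ge> 0" for x
    using \<omega>_pos by (auto simp: W_def indicator_def less_imp_le)
  obtain Cw where Cw: "Cw \<ge> 0" "AE x in lebesgue. x \<in> {a..b} \<longrightarrow> \<bar>\<omega> x\<bar> \<le> Cw"
    and W_meas: "W \<in> borel_measurable lebesgue"
    using Linf_onE[of "{a..b}" \<omega>] assms(2) unfolding W_def weight_def by auto
  obtain Cg where Cg: "Cg \<ge> 0" "AE x in lebesgue. x \<in> {a..b} \<longrightarrow> \<bar>g x\<bar> \<le> Cg"
    and g0_meas: "g0 \<in> borel_measurable lebesgue"
    using Linf_onE[of "{a..b}" g] assms(5) unfolding g0_def by auto
  have F_Linf: "AE y in lebesgue_on {a..<b}. F_ker b \<omega> k y < \<infinity>"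
    "Linf_on {a..<b} (\<lambda>y. enn2real (F_ker b \<omega> k y))"
    using assms(3) by (auto simp: kernels_def Linf_on_ennreal_def)
  obtain CF where CF: "CF \<ge> 0" "AE y in lebesgue. y \<in> {a..<b} \<longrightarrow> \<bar>enn2real (F_ker b \<omega> k y)\<bar> \<le> CF"
    using Linf_onE[OF F_Linf(2)] by auto
  \<comment> \<open>\<open>enn2real\<close> sends \<open>\<infinity>\<close> to \<open>0\<close>, so
    the bound \<open>CF\<close> says something about \<open>F_ker\<close> only where
    \<open>F_ker\<close> is finite. At the endpoint \<open>y = b\<close> the domain of integration
    is empty and \<open>F_ker\<close> vanishes.\<close>
  have "AE y in lebesgue. y \<in> {a..<b} \<longrightarrow> F_ker b \<omega> k y < \<infinity>"
    using F_Linf(1) by (simp add: AE_restrict_space_iff)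
  with CF(2) have F_bound: "AE y in lebesgue. y \<in> {a..b} \<longrightarrow> F_ker b \<omega> k y \<le> ennreal CF"
  proof eventually_elim
    case (elim y)
    show ?case
    proof (cases "y = b")
      case False
      then have "F_ker b \<omega> k y = ennreal (enn2real (F_ker b \<omega> k y))" if "y \<in> {a..b}"
        using elim that by simp
      then show ?thesis
        using elim False by (metis abs_le_D1 atLeastAtMost_iff atLeastLessThan_iff ennreal_leI order_le_less)
    qed (simp add: F_ker_def)
  qed
  have f0_int: "integrable lebesgue f0"
    using assms(4) by (simp add: f0_def set_integrable_def)
  then have f0_meas: "f0 \<in> borel_measurable lebesgue"
    by auto
  have K_meas: "K \<in> borel_measurable lebesgue"
    using assms(3) borel_Omega[of a b] unfolding K_def kernels_def
    by (simp add: borel_measurable_restrict_space_iff)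
  have h_meas: "h \<in> borel_measurable lebesgue"
    unfolding h_def
    using K_meas borel_measurable_lebesgue_snd[OF f0_meas] borel_measurable_lebesgue_snd[OF W_meas]
      borel_measurable_lebesgue_fst[OF g0_meas] borel_measurable_lebesgue_fst[OF W_meas]
    by (intro borel_measurable_times)
  \<comment> \<open>With \<open>W y\<close> and \<open>g0 x\<close> replaced by their bounds, the
    remaining dependence on \<open>x\<close> is \<open>K (x, y) * W x\<close>, whose integral is
    \<open>F_ker b \<omega> k y\<close>. What is left is a constant times the integrable
    \<open>\<bar>f0 y\<bar>\<close>.\<close>
  have inner: "AE y in lebesgue.
      (\<integral>\<^sup>+x. ennreal \<bar>h (x, y)\<bar> \<partial>lebesgue) \<le> ennreal (Cw * Cg * CF) * ennreal \<bar>f0 y\<bar>"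
    using F_bound Cw(2) AE_borel_measurable_lebesgue_section[OF K_meas]
  proof eventually_elim
    case (elim y)
    show ?case
    proof (cases "y \<in> {a..b}")
      case True
      have "(\<integral>\<^sup>+x. ennreal \<bar>h (x, y)\<bar> \<partial>lebesgue)
          \<le> (\<integral>\<^sup>+x. ennreal (\<bar>f0 y\<bar> * Cw * Cg) * ennreal (K (x, y) * W x) \<partial>lebesgue)"
      proof (rule nn_integral_mono_AE)
        show "AE x in lebesgue. ennreal \<bar>h (x, y)\<bar>
            \<le> ennreal (\<bar>f0 y\<bar> * Cw * Cg) * ennreal (K (x, y) * W x)"
          using Cg(2)
        proof eventually_elim
          case (elim x)
          have g0: "\<bar>g0 x\<bar> \<le> Cg"
            using elim Cg(1) by (auto simp: g0_def indicator_def)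
          have W: "W y \<le> Cw"
            using \<open>y \<in> {a..b} \<longrightarrow> \<bar>\<omega> y\<bar> \<le> Cw\<close> True by (auto simp: W_def)
          have "\<bar>h (x, y)\<bar> = (\<bar>f0 y\<bar> * (W y * \<bar>g0 x\<bar>)) * (K (x, y) * W x)"
            using K_nonneg[of "(x, y)"] W_nonneg[of x] W_nonneg[of y] by (simp add: h_def abs_mult)
          also have "\<dots> \<le> (\<bar>f0 y\<bar> * (Cw * Cg)) * (K (x, y) * W x)"
            using g0 W W_nonneg[of x] K_nonneg[of "(x, y)"] Cw(1)
            by (intro mult_right_mono mult_left_mono mult_mono) auto
          finally show ?case
            using Cw(1) Cg(1) W_nonneg[of x] K_nonneg[of "(x, y)"]
            by (simp add: ennreal_mult[symmetric] ennreal_leI mult.assoc)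
        qed
      qed
      \<comment> \<open>Extracting the constant uses measurability of the section of
        \<open>K\<close>, which is available for almost every \<open>y\<close>.\<close>
      also have "\<dots> = ennreal (\<bar>f0 y\<bar> * Cw * Cg) * (\<integral>\<^sup>+x. ennreal (K (x, y) * W x) \<partial>lebesgue)"
        using elim(3) W_meas by (intro nn_integral_cmult) auto
      also have "(\<integral>\<^sup>+x. ennreal (K (x, y) * W x) \<partial>lebesgue) = F_ker b \<omega> k y"
        unfolding F_ker_def using True
        by (intro nn_integral_cong) (auto simp: K_def W_def Omega_def indicator_def)
      also have "ennreal (\<bar>f0 y\<bar> * Cw * Cg) * F_ker b \<omega> k y \<le> ennreal (\<bar>f0 y\<bar> * Cw * Cg) * ennreal CF"
        using elim(1) True by (intro mult_left_mono) auto
      also have "\<dots> = ennreal (Cw * Cg * CF) * ennreal \<bar>f0 y\<bar>"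
        using Cw(1) Cg(1) CF(1) by (simp add: ennreal_mult[symmetric] mult_ac)
      finally show ?thesis .
    qed (simp add: h_def f0_def)
  qed
  have "(\<integral>\<^sup>+y. (\<integral>\<^sup>+x. ennreal \<bar>h (x, y)\<bar> \<partial>lebesgue) \<partial>lebesgue)
      \<le> (\<integral>\<^sup>+y. ennreal (Cw * Cg * CF) * ennreal \<bar>f0 y\<bar> \<partial>lebesgue)"
    using inner by (rule nn_integral_mono_AE)
  also have "\<dots> = ennreal (Cw * Cg * CF) * (\<integral>\<^sup>+y. ennreal \<bar>f0 y\<bar> \<partial>lebesgue)"
    using f0_meas by (intro nn_integral_cmult) auto
  also have "\<dots> < \<infinity>"
    using f0_int by (auto simp: integrable_iff_bounded ennreal_mult_less_top)
  finally have Fubini: "(\<integral>x. (\<integral>y. h (x, y) \<partial>lebesgue) \<partial>lebesgue) = (\<integral>y. (\<integral>x. h (x, y) \<partial>lebesgue) \<partial>lebesgue)"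
    using h_meas by (intro lebesgue_Fubini_integral)
  \<comment> \<open>For \<open>x\<close> in \<open>[a,b]\<close> the section of
    \<open>Omega a b\<close> is \<open>{a..<x}\<close>; otherwise both sides are \<open>0\<close>.
    The factor \<open>g0 x * W x\<close> leaves the Bochner integral even if the section is not
    integrable, so the identity holds for every \<open>x\<close>.\<close>
  have left: "indicator {a..b} x *\<^sub>R (left_integral a \<omega> k f x * g x * \<omega> x) = (\<integral>y. h (x, y) \<partial>lebesgue)" for x
  proof -
    have "(\<integral>y. h (x, y) \<partial>lebesgue) =
        (\<integral>y. (indicator {a..<x} y *\<^sub>R (k (x, y) * f y * \<omega> y)) * (g0 x * W x) \<partial>lebesgue)"
      by (intro Bochner_Integration.integral_cong)
        (auto simp: h_def K_def f0_def g0_def W_def Omega_def indicator_def)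
    then show ?thesis
      by (simp add: left_integral_def set_lebesgue_integral_def g0_def W_def indicator_def)
  qed
  have right: "indicator {a..b} y *\<^sub>R (right_integral b \<omega> k g y * f y * \<omega> y) = (\<integral>x. h (x, y) \<partial>lebesgue)" for y
  proof -
    have "(\<integral>x. h (x, y) \<partial>lebesgue) =
        (\<integral>x. (indicator {y<..b} x *\<^sub>R (k (x, y) * g x * \<omega> x)) * (f0 y * W y) \<partial>lebesgue)"
      by (intro Bochner_Integration.integral_cong)
        (auto simp: h_def K_def f0_def g0_def W_def Omega_def indicator_def)
    then show ?thesis
      by (simp add: right_integral_def set_lebesgue_integral_def f0_def W_def indicator_def)
  qed
  show ?thesis
    using Fubini unfolding set_lebesgue_integral_def left right .
qed

end
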